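(* Let $G$ be a finite connected weighted graph and let $p\ge 1$. Denote by $0=\lambda_1<\lambda_2\le\dots\le\lambda_n$ the variational eigenvalues of the graph $p$-Laplacian $\Delta_p$ on $G$. Let $\lambda$ be an eigenvalue of $\Delta_p$ such that $\lambda<\lambda_k$ (for some $k\in\{1,\dots,n\}$). Then any eigenfunction of $\Delta_p$ associated to $\lambda$ induces at most $k-1$ strong nodal domains.
   Context: Graph: $G$ is a finite, connected, undirected graph with vertex set $V$, $n=|V|$, edge set $E$, strictly positive vertex weights $\mu(u)>0$ ($u\in V$) and symmetric edge weights $w(uv)=w(vu)$, with $w(uv)>0$ if $uv\in E$ and $w(uv)=0$ if $uv\notin E$. Eigenpairs for $p>1$: put $\Phi_p(x)=|x|^{p-2}x$ (with $\Phi_p(0)=0$) and $(\Delta_p f)(u)=\sum_{v\in V}w(uv)\Phi_p(f(u)-f(v))$ for $f:V\to\mathbb{R}$. A nonzero $f:V\to\mathbb{R}$ is an eigenfunction of $\Delta_p$ with eigenvalue $\lambda\in\mathbb R$ if $(\Delta_p f)(u)=\lambda\,\mu(u)\Phi_p(f(u))$ for all $u\in V$. Eigenpairs for $p=1$: let $\mathrm{Sign}(x)=\{1\}$ if $x>0$, $\{-1\}$ if $x<0$, and $[-1,1]$ if $x=0$. A nonzero $f:V\to\mathbb{R}$ is an eigenfunction of $\Delta_1$ with eigenvalue $\lambda$ if there are numbers $z(uv)$, $u,v\in V$, with $z(uv)=-z(vu)$ and $z(uv)\in\mathrm{Sign}(f(u)-f(v))$, such that $\sum_{v\in V}w(uv)z(uv)\in\lambda\,\mu(u)\,\mathrm{Sign}(f(u))$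 for all $u\in V$. Variational eigenvalues: for nonzero $f:V\to\mathbb R$ let $\mathcal{R}_p(f)=\frac12\,\frac{\sum_{u,v\in V}w(uv)|f(u)-f(v)|^p}{\sum_{u\in V}\mu(u)|f(u)|^p}$, and let $\mathcal{S}_p=\{g:V\to\mathbb{R}:\sum_{u}\mu(u)|g(u)|^p=1\}$. For a closed symmetric set $A=-A\subseteq\mathcal{S}_p$ the Krasnoselskii genus $\gamma(A)$ is $0$ if $A=\emptyset$, and otherwise the smallest integer $m$ for which there is a continuous odd map $h:A\to\mathbb{R}^m\setminus\{0\}$ ($\infty$ if there is none). Let $\mathcal{F}_k(\mathcal{S}_p)=\{A\subseteq\mathcal{S}_p: A=-A,\ A\text{ closed},\ \gamma(A)\ge k\}$. The variational eigenvalues are $\lambda_k=\lambda_k^{(p)}=\min_{A\in\mathcal{F}_k(\mathcal{S}_p)}\max_{f\in A}\mathcal{R}_p(f)$, $k=1,\dots,n$. Strong nodal domains: a subset $A\subseteq V$ is a strong nodal domain induced by $f:V\to\mathbb R$ if the subgraph induced by $A$ is a maximal connected component of (the subgraph induced by) either $\{u:f(u)>0\}$ or $\{u:f(u)<0\}$. *)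

theory Defs
  imports "HOL-Analysis.Analysis"
begin

text \<open>
  The vertex set is the universe of a finite type \<open>'v\<close>, so that \<open>n = CARD('v)\<close> and the functions
  \<open>f : V \<rightarrow> \<real>\<close> are the vectors of \<open>real ^ 'v\<close>. The edge set is a symmetric relation, a pair
  \<open>(u, v)\<close> and its converse standing for one undirected edge. Loops are not excluded; they do not
  affect any of the notions below.
\<close>

locale weighted_graph =
  fixes E :: "('v::finite \<times> 'v) set"
    and w :: "'v \<Rightarrow> 'v \<Rightarrow> real"
    and \<mu> :: "'v \<Rightarrow> real"
  assumes undirected: "sym E"
    and connected: "\<And>u v. (u, v) \<in> E\<^sup>*"
    and \<mu>_pos: "\<And>u. \<mu> u > 0"
    and w_sym: "\<And>u v. w u v = w v u"
    and w_edge: "\<And>u v. (u, v) \<in> E \<Longrightarrow> w u v > 0"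
    and w_non_edge: "\<And>u v. (u, v) \<notin> E \<Longrightarrow> w u v = 0"


subsection \<open>Eigenpairs\<close>

text \<open>Since \<open>0 powr a = 0\<close>, this satisfies \<open>\<Phi> p 0 = 0\<close> for every \<open>p\<close>.\<close>

definition \<Phi> :: "real \<Rightarrow> real \<Rightarrow> real"
  where "\<Phi> p x = \<bar>x\<bar> powr (p - 2) * x"

definition p_laplacian :: "('v::finite \<Rightarrow> 'v \<Rightarrow> real) \<Rightarrow> real \<Rightarrow> real ^ 'v \<Rightarrow> 'v \<Rightarrow> real"
  where "p_laplacian w p f u = (\<Sum>v\<in>UNIV. w u v * \<Phi> p (f $ u - f $ v))"

definition Sign :: "real \<Rightarrow> real set"
  where "Sign x = (if x > 0 then {1} else if x < 0 then {-1} else {-1..1})"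

text \<open>Meaningful for \<open>p \<ge> 1\<close> only: the second case is intended for \<open>p > 1\<close>.\<close>

definition is_eigenfunction ::
    "('v::finite \<Rightarrow> 'v \<Rightarrow> real) \<Rightarrow> ('v \<Rightarrow> real) \<Rightarrow> real \<Rightarrow> real \<Rightarrow> real ^ 'v \<Rightarrow> bool"
  where "is_eigenfunction w \<mu> p lam f \<longleftrightarrow>
    f \<noteq> 0 \<and>
    (if p = 1 then
       (\<exists>z :: 'v \<Rightarrow> 'v \<Rightarrow> real.
          (\<forall>u v. z u v = - z v u) \<and>
          (\<forall>u v. z u v \<in> Sign (f $ u - f $ v)) \<and>
          (\<forall>u. (\<Sum>v\<in>UNIV. w u v * z u v) \<in> (\<lambda>s. lam * \<mu> u * s) ` Sign (f $ u)))
     else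
       (\<forall>u. p_laplacian w p f u = lam * \<mu> u * \<Phi> p (f $ u)))"

definition is_eigenvalue ::
    "('v::finite \<Rightarrow> 'v \<Rightarrow> real) \<Rightarrow> ('v \<Rightarrow> real) \<Rightarrow> real \<Rightarrow> real \<Rightarrow> bool"
  where "is_eigenvalue w \<mu> p lam \<longleftrightarrow> (\<exists>f. is_eigenfunction w \<mu> p lam f)"


subsection \<open>Variational eigenvalues\<close>

definition rayleigh ::
    "('v::finite \<Rightarrow> 'v \<Rightarrow> real) \<Rightarrow> ('v \<Rightarrow> real) \<Rightarrow> real \<Rightarrow> real ^ 'v \<Rightarrow> real"
  where "rayleigh w \<mu> p f =
    1 / 2 * ((\<Sum>u\<in>UNIV. \<Sum>v\<in>UNIV. w u v * \<bar>f $ u - f $ v\<bar> powr p) /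
             (\<Sum>u\<in>UNIV. \<mu> u * \<bar>f $ u\<bar> powr p))"

definition p_sphere :: "('v::finite \<Rightarrow> real) \<Rightarrow> real \<Rightarrow> (real ^ 'v) set"
  where "p_sphere \<mu> p = {g. (\<Sum>u\<in>UNIV. \<mu> u * \<bar>g $ u\<bar> powr p) = 1}"

text \<open>
  \<open>Euclidean_space m\<close> is \<open>\<real>\<^sup>m\<close> as a topology on the sequences vanishing from index \<open>m\<close> on; its
  origin is the zero sequence.
\<close>

definition odd_map_into :: "(real ^ 'v::finite) set \<Rightarrow> nat \<Rightarrow> (real ^ 'v \<Rightarrow> nat \<Rightarrow> real) \<Rightarrow> bool"
  where "odd_map_into A m h \<longleftrightarrow>
    continuous_map (top_of_set A)
      (subtopology (Euclidean_space m) (topspace (Euclidean_space m) - {\<lambda>i. 0})) h \<and>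
    (\<forall>x\<in>A. h (- x) = (\<lambda>i. - h x i))"

text \<open>In \<open>enat\<close>, the infimum of a nonempty set is its least element, and \<open>Inf {} = \<infinity>\<close>.\<close>

definition genus :: "(real ^ 'v::finite) set \<Rightarrow> enat"
  where "genus A = (if A = {} then 0 else Inf {enat m |m. \<exists>h. odd_map_into A m h})"

definition genus_family ::
    "('v::finite \<Rightarrow> real) \<Rightarrow> real \<Rightarrow> nat \<Rightarrow> (real ^ 'v) set set"
  where "genus_family \<mu> p k =
    {A. A \<subseteq> p_sphere \<mu> p \<and> uminus ` A = A \<and> closed A \<and> genus A \<ge> enat k}"

text \<open>
  For \<open>1 \<le> k \<le> n\<close> and \<open>p \<ge> 1\<close>, the family is nonempty, its members are nonempty and compact, and
  both extrema are attained, so infimum and supremum are the minimum and maximum of the usual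
  formula.
\<close>

definition variational_eigenvalue ::
    "('v::finite \<Rightarrow> 'v \<Rightarrow> real) \<Rightarrow> ('v \<Rightarrow> real) \<Rightarrow> real \<Rightarrow> nat \<Rightarrow> real"
  where "variational_eigenvalue w \<mu> p k =
    (INF A\<in>genus_family \<mu> p k. SUP f\<in>A. rayleigh w \<mu> p f)"


subsection \<open>Strong nodal domains\<close>

definition connected_in :: "('v \<times> 'v) set \<Rightarrow> 'v set \<Rightarrow> bool"
  where "connected_in E A \<longleftrightarrow> A \<noteq> {} \<and> (\<forall>u\<in>A. \<forall>v\<in>A. (u, v) \<in> (E \<inter> A \<times> A)\<^sup>*)"

definition component_of :: "('v \<times> 'v) set \<Rightarrow> 'v set \<Rightarrow> 'v set \<Rightarrow> bool"
  where "component_of E S A \<longleftrightarrow>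
    A \<subseteq> S \<and> connected_in E A \<and> (\<forall>B. A \<subseteq> B \<and> B \<subseteq> S \<and> connected_in E B \<longrightarrow> B = A)"

definition strong_nodal_domain ::
    "('v::finite \<times> 'v) set \<Rightarrow> real ^ 'v \<Rightarrow> 'v set \<Rightarrow> bool"
  where "strong_nodal_domain E f A \<longleftrightarrow>
    component_of E {u. f $ u > 0} A \<or> component_of E {u. f $ u < 0} A"

end

theory Submission
  imports Defs "HOL-Homology.Invariance_of_Domain"
begin

text \<open>
  Let \<open>f\<close> be an eigenfunction for \<open>lam\<close> with \<open>m\<close> strong nodal domains. The functions \<open>c * f\<close>, with
  \<open>c\<close> constant on each nodal domain, form the \<open>m\<close>-dimensional span of the restrictions of \<open>f\<close> to its
  domains. Intersected with the sphere of \<open>p\<close>-norm \<open>1\<close>, this space gives a closed symmetric set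
  \<open>A\<close>. Two facts about \<open>A\<close> show that \<open>lam\<close> bounds every variational
  eigenvalue of index at most \<open>m\<close>, so \<open>lam < \<lambda>\<^sub>k\<close> forces \<open>m < k\<close>.

  On \<open>A\<close> the Rayleigh quotient is at most \<open>lam\<close> (\<open>rayleigh_nodal_multiple_le\<close>). Edge by edge,
  convexity of the power bounds the energy of \<open>c * f\<close> by the flux of \<open>f\<close> tested
  with \<open>\<bar>c\<bar> powr p * f\<close> (\<open>edge_energy_le\<close>): \<open>c\<close> changes only along edges on which \<open>f\<close> changes sign or
  vanishes at an end. Summation by parts and the eigenvalue equation then give \<open>lam\<close>. The flux is
  \<open>\<Phi> p (f u - f v)\<close> for \<open>p > 1\<close> and the selection of signs \<open>z u v\<close> for \<open>p = 1\<close>; with it both cases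
  have the same proof.

  The genus of \<open>A\<close> is at least \<open>m\<close> (\<open>genus_nodal_multiples\<close>), because an odd map sends the
  sphere of dimension \<open>m - 1\<close> into \<open>A\<close>. This is the topological content, the Borsuk-Ulam theorem. It
  is derived from the theorem that an odd self-map of a sphere has odd degree
  (\<open>Borsuk_odd_mapping_degree\<close>): a map into the equator is not surjective and has degree \<open>0\<close>.
\<close>

section \<open>Radial projection onto the sphere and the Brouwer degree\<close>

definition radial :: "nat \<Rightarrow> (nat \<Rightarrow> real) \<Rightarrow> nat \<Rightarrow> real"
  where "radial n q = (\<lambda>i. if i \<le> n then q i / sqrt (\<Sum>j\<le>n. (q j)\<^sup>2) else 0)"

lemma topspace_nsphere: "topspace (nsphere n) = {x. (\<Sum>i\<le>n. (x i)\<^sup>2) = 1 \<and> (\<forall>i>n. x i = 0)}"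
  by (simp add: nsphere)

lemma sum_squares_pos:
  fixes q :: "nat \<Rightarrow> real"
  assumes "\<exists>i\<le>n. q i \<noteq> 0"
  shows "(\<Sum>j\<le>n. (q j)\<^sup>2) > 0"
proof -
  obtain i where "i \<le> n" "q i \<noteq> 0" using assms by blast
  then show ?thesis by (intro sum_pos2[of _ i]) auto
qed

lemma nsphere_nonzero:
  assumes "x \<in> topspace (nsphere n)"
  shows "\<exists>i\<le>n. x i \<noteq> 0"
proof (rule ccontr)
  assume "\<not> ?thesis"
  then have "(\<Sum>i\<le>n. (x i)\<^sup>2) = 0" by simp
  with assms show False by (simp add: topspace_nsphere)
qed

lemma radial_in_nsphere:
  assumes "\<exists>i\<le>n. q i \<noteq> 0"
  shows "radial n q \<in> topspace (nsphere n)"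
proof -
  have "(\<Sum>i\<le>n. (q i / sqrt (\<Sum>j\<le>n. (q j)\<^sup>2))\<^sup>2) = (\<Sum>i\<le>n. (q i)\<^sup>2) / (\<Sum>j\<le>n. (q j)\<^sup>2)"
    by (simp add: power_divide sum_nonneg flip: sum_divide_distrib)
  also have "\<dots> = 1" using sum_squares_pos[OF assms] by simp
  finally show ?thesis by (simp add: topspace_nsphere radial_def)
qed

lemma radial_of_nsphere:
  assumes "x \<in> topspace (nsphere n)"
  shows "radial n x = x"
  using assms by (auto simp: topspace_nsphere radial_def fun_eq_iff)

lemma radial_minus: "radial n (\<lambda>i. - q i) = (\<lambda>i. - radial n q i)"
  by (auto simp: radial_def)

lemma continuous_map_radial:
  assumes "\<And>i. i \<le> n \<Longrightarrow> continuous_map X euclideanreal (\<lambda>x. q x i)"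
    and "\<And>x. x \<in> topspace X \<Longrightarrow> \<exists>i\<le>n. q x i \<noteq> 0"
  shows "continuous_map X (nsphere n) (\<lambda>x. radial n (q x))"
  unfolding nsphere continuous_map_in_subtopology continuous_map_componentwise_UNIV
proof (intro conjI allI)
  fix k
  show "continuous_map X euclideanreal (\<lambda>x. radial n (q x) k)"
  proof (cases "k \<le> n")
    case True
    have "continuous_map X euclideanreal (\<lambda>x. q x k / sqrt (\<Sum>j\<le>n. (q x j)\<^sup>2))"
      using assms(1) True sum_squares_pos[OF assms(2)]
      by (intro continuous_intros) (auto simp: less_imp_neq[THEN not_sym])
    then show ?thesis using True by (simp add: radial_def)
  qed (simp add: radial_def)
next
  show "(\<lambda>x. radial n (q x)) \<in> topspace X \<rightarrow> {x. (\<Sum>i\<le>n. (x i)\<^sup>2) = 1 \<and> (\<forall>i>n. x i = 0)}"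
    using radial_in_nsphere[OF assms(2)] by (auto simp: topspace_nsphere)
qed

text \<open>
  Maps into a sphere are most easily deformed by straight segments in the surrounding space: as
  long as the segment avoids the origin, projecting it radially gives a homotopy.
\<close>

lemma Brouwer_degree2_radial_segment:
  assumes f: "\<And>i. i \<le> n \<Longrightarrow> continuous_map (nsphere n) euclideanreal (\<lambda>x. f x i)"
    and g: "\<And>i. i \<le> n \<Longrightarrow> continuous_map (nsphere n) euclideanreal (\<lambda>x. g x i)"
    and nz: "\<And>x t. \<lbrakk>x \<in> topspace (nsphere n); 0 \<le> t; t \<le> 1\<rbrakk>
               \<Longrightarrow> \<exists>i\<le>n. (1 - t) * f x i + t * g x i \<noteq> 0"
  shows "Brouwer_degree2 n (\<lambda>x. radial n (f x)) = Brouwer_degree2 n (\<lambda>x. radial n (g x))"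
proof (rule Brouwer_degree2_homotopic)
  let ?X = "prod_topology (top_of_set {0..1::real}) (nsphere n)"
  let ?h = "\<lambda>z. radial n (\<lambda>i. (1 - fst z) * f (snd z) i + fst z * g (snd z) i)"
  have fst: "continuous_map ?X euclideanreal fst"
    using continuous_map_fst continuous_map_in_subtopology by blast
  have comp: "continuous_map ?X euclideanreal (\<lambda>z. u (snd z))"
    if "continuous_map (nsphere n) euclideanreal u" for u
    using continuous_map_compose[OF continuous_map_snd that] by (simp add: o_def)
  have "continuous_map ?X (nsphere n) ?h"
    by (rule continuous_map_radial) (auto intro!: continuous_intros fst comp f g nz)
  then show "homotopic_with (\<lambda>_. True) (nsphere n) (nsphere n)
      (\<lambda>x. radial n (f x)) (\<lambda>x. radial n (g x))"
    unfolding homotopic_with_def by (intro exI[of _ ?h]) auto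
qed

section \<open>Generic odd maps\<close>

text \<open>
  Weierstrass approximation respects the symmetry, because the odd part of an approximating
  polynomial approximates at least as well.
\<close>

lemma odd_polynomial_approximation:
  fixes f :: "'a::euclidean_space \<Rightarrow> 'b::euclidean_space"
  assumes "compact S" and "continuous_on S f" and "e > 0"
    and sym: "\<And>x. x \<in> S \<Longrightarrow> - x \<in> S" and odd: "\<And>x. x \<in> S \<Longrightarrow> f (- x) = - f x"
  obtains g where "polynomial_function g" "\<And>x. g (- x) = - g x"
    "\<And>x. x \<in> S \<Longrightarrow> norm (f x - g x) < e"
proof -
  obtain h where h: "polynomial_function h" "\<And>x. x \<in> S \<Longrightarrow> norm (f x - h x) < e"
    using Stone_Weierstrass_polynomial_function[OF assms(1-3)] by blast
  define g where "g = (\<lambda>x. (1/2) *\<^sub>R (h x - h (- x)))"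
  have "polynomial_function (h \<circ> (\<lambda>x. - x))"
    by (intro polynomial_function_compose h) auto
  then have "polynomial_function g"
    using h(1) unfolding g_def o_def by (intro polynomial_function_cmul polynomial_function_diff)
  moreover have "g (- x) = - g x" for x
    by (simp add: g_def algebra_simps)
  moreover have "norm (f x - g x) < e" if "x \<in> S" for x
  proof -
    have "f x - g x = (1/2) *\<^sub>R ((f x - h x) - (f (- x) - h (- x)))"
      using odd[OF that] by (simp add: g_def algebra_simps flip: scaleR_add_left)
    then have "norm (f x - g x) \<le> (1/2) * (norm (f x - h x) + norm (f (- x) - h (- x)))"
      using norm_triangle_ineq4[of "f x - h x" "f (- x) - h (- x)"] by simp
    also have "\<dots> < (1/2) * (e + e)"
      by (intro mult_strict_left_mono add_strict_mono h(2) that sym) auto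
    finally show ?thesis by simp
  qed
  ultimately show thesis using that by blast
qed

text \<open>Every ray from the origin meets the cylinder over the unit sphere of \<open>\<real>\<^sup>I\<close> at most once.\<close>

lemma negligible_cylinder:
  fixes I :: "'v::finite set"
  shows "negligible {y::real^'v. (\<Sum>v\<in>I. (y $ v)\<^sup>2) = 1}" (is "negligible ?Z")
proof (rule starlike_negligible[where a = 0])
  show "closed ?Z"
    by (intro closed_Collect_eq continuous_intros)
  fix c and x :: "real^'v"
  assume c: "0 + c *\<^sub>R x \<in> ?Z" "0 \<le> c" "0 + x \<in> ?Z"
  then have "c\<^sup>2 * (\<Sum>v\<in>I. (x $ v)\<^sup>2) = 1"
    by (simp add: power_mult_distrib flip: sum_distrib_left)
  with c(3) have "c\<^sup>2 = 1" by simp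
  with c(2) show "c = 1" by (simp add: power2_eq_1_iff)
qed

text \<open>
  The unit sphere of \<open>\<real>\<^sup>I\<close> has smaller dimension than \<open>\<real>\<^sup>I\<close>, so a differentiable map cannot send
  it onto \<open>\<real>\<^sup>I\<close>; here the map is the quotient \<open>Q / s\<close>, and \<open>d\<close> is a value that it misses. The
  coordinates outside \<open>I\<close> are carried along unchanged. The sphere becomes a cylinder in the whole
  space, and the dimension count becomes the fact that differentiable maps preserve negligible sets.
\<close>

lemma missing_slope:
  fixes Q :: "real^'v \<Rightarrow> real^'v::finite" and s :: "real^'v \<Rightarrow> real"
  assumes Q: "\<And>x. Q differentiable (at x)" and s: "\<And>x. s differentiable (at x)"
  obtains d :: "real^'v" where
    "\<And>x. \<lbrakk>(\<Sum>v\<in>I. (x $ v)\<^sup>2) = 1; \<And>v. v \<notin> I \<Longrightarrow> x $ v = 0; s x \<noteq> 0\<rbrakk>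
        \<Longrightarrow> \<exists>v\<in>I. Q x $ v \<noteq> d $ v * s x"
proof -
  define \<pi> :: "real^'v \<Rightarrow> real^'v" where "\<pi> = (\<lambda>y. \<chi> v. if v \<in> I then y $ v else 0)"
  define Z where "Z = {y::real^'v. (\<Sum>v\<in>I. (y $ v)\<^sup>2) = 1} \<inter> {y. s (\<pi> y) \<noteq> 0}"
  define \<Psi> :: "real^'v \<Rightarrow> real^'v" where
    "\<Psi> = (\<lambda>y. \<chi> v. if v \<in> I then Q (\<pi> y) $ v / s (\<pi> y) else y $ v)"
  have "linear \<pi>" by (auto simp: \<pi>_def linear_iff vec_eq_iff)
  then have \<pi>: "\<pi> differentiable (at y)" for y
    by (rule linear_imp_differentiable)
  have Q\<pi>: "(\<lambda>y. Q (\<pi> y)) differentiable (at y)" for y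
    using differentiable_chain_at[OF \<pi> Q] by (simp add: o_def)
  have s\<pi>: "(\<lambda>y. s (\<pi> y)) differentiable (at y)" for y
    using differentiable_chain_at[OF \<pi> s] by (simp add: o_def)
  have "\<Psi> differentiable (at y within Z)" if "y \<in> Z" for y
  proof -
    have "(\<lambda>y. \<Psi> y $ v) differentiable (at y within Z)" for v
    proof (cases "v \<in> I")
      case True
      have "(\<lambda>y. Q (\<pi> y) $ v) differentiable (at y)"
        using differentiable_chain_at[OF Q\<pi>[of y]
            bounded_linear_imp_differentiable[OF bounded_linear_vec_nth[of v]]]
        by (simp add: o_def)
      then have "(\<lambda>y. Q (\<pi> y) $ v / s (\<pi> y)) differentiable (at y)"
        using s\<pi>[of y] that by (intro differentiable_divide) (auto simp: Z_def)
      then show ?thesis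
        using True by (simp add: \<Psi>_def differentiable_at_withinI)
    next
      case False
      have "(\<lambda>y::real^'v. y $ v) differentiable (at y within Z)"
        by (simp add: bounded_linear_imp_differentiable bounded_linear_vec_nth)
      then show ?thesis using False by (simp add: \<Psi>_def)
    qed
    then show ?thesis
      by (subst differentiable_componentwise_within) (auto simp: Basis_vec_def inner_axis)
  qed
  then have "\<Psi> differentiable_on Z" by (simp add: differentiable_on_def)
  moreover have "negligible Z"
    unfolding Z_def by (rule negligible_subset[OF negligible_cylinder[of I]]) simp
  ultimately have "negligible (\<Psi> ` Z)"
    by (intro negligible_differentiable_image_negligible) auto
  then have "\<Psi> ` Z \<noteq> UNIV"
    using non_negligible_UNIV by metis
  then obtain d where d: "d \<notin> \<Psi> ` Z" by blast
  show thesis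
  proof
    fix x :: "real^'v"
    assume x: "(\<Sum>v\<in>I. (x $ v)\<^sup>2) = 1" "\<And>v. v \<notin> I \<Longrightarrow> x $ v = 0" "s x \<noteq> 0"
    show "\<exists>v\<in>I. Q x $ v \<noteq> d $ v * s x"
    proof (rule ccontr)
      assume contra: "\<not> ?thesis"
      \<comment> \<open>Outside \<open>I\<close> the map \<open>\<Psi>\<close> is the identity, so there \<open>y\<close> has to copy \<open>d\<close>.\<close>
      define y :: "real^'v" where "y = (\<chi> v. if v \<in> I then x $ v else d $ v)"
      have [simp]: "\<pi> y = x" using x(2) by (auto simp: \<pi>_def y_def vec_eq_iff)
      have "(\<Sum>v\<in>I. (y $ v)\<^sup>2) = 1" using x(1) by (simp add: y_def)
      then have "y \<in> Z" using x(3) by (simp add: Z_def)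
      moreover have "\<Psi> y $ v = d $ v" for v
      proof (cases "v \<in> I")
        case True
        then have "\<Psi> y $ v = Q x $ v / s x" by (simp add: \<Psi>_def)
        then show ?thesis using True contra x(3) by simp
      next
        case False
        then show ?thesis by (simp add: \<Psi>_def y_def)
      qed
      then have "\<Psi> y = d" by (simp add: vec_eq_iff)
      ultimately show False using d by blast
    qed
  qed
qed

definition coordinate_embedding :: "(nat \<Rightarrow> 'v) \<Rightarrow> nat \<Rightarrow> (nat \<Rightarrow> real) \<Rightarrow> real ^ 'v::finite"
  where "coordinate_embedding e n x = (\<Sum>j\<le>n. x j *\<^sub>R axis (e j) 1)"

lemma coordinate_embedding_nth:
  assumes "inj_on e {..n}" "i \<le> n"
  shows "coordinate_embedding e n x $ e i = x i"
proof -
  have "coordinate_embedding e n x $ e i = (\<Sum>j\<le>n. if j = i then x j else 0)"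
    unfolding coordinate_embedding_def sum_component
    using assms by (intro sum.cong) (auto simp: axis_def dest: inj_onD)
  then show ?thesis using assms(2) by simp
qed

lemma coordinate_embedding_other: "v \<notin> e ` {..n} \<Longrightarrow> coordinate_embedding e n x $ v = 0"
  unfolding coordinate_embedding_def sum_component by (intro sum.neutral) (auto simp: axis_def)

lemma coordinate_embedding_minus:
  "coordinate_embedding e n (\<lambda>i. - x i) = - coordinate_embedding e n x"
  by (simp add: coordinate_embedding_def sum_negf)

text \<open>
  The spheres of the degree theory live in a space of sequences, whereas approximation and
  differentiation need a Euclidean space; the embedding along distinct coordinates \<open>e 0, ..., e n\<close>
  translates between the two. The bound \<open>1\<close> is what keeps the segment from \<open>f\<close> to the
  approximation away from the origin.
\<close>

lemma odd_map_polynomial_model: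
  fixes e :: "nat \<Rightarrow> 'v::finite"
  assumes e: "inj_on e {..n}"
    and f: "continuous_map (nsphere n) (nsphere n) f"
    and odd: "\<And>x. x \<in> topspace (nsphere n) \<Longrightarrow> f (\<lambda>i. - x i) = (\<lambda>i. - f x i)"
  obtains P :: "real^'v \<Rightarrow> real^'v" where "polynomial_function P" "\<And>y. P (- y) = - P y"
    "\<And>x. x \<in> topspace (nsphere n) \<Longrightarrow>
       (\<Sum>i\<le>n. (f x i - P (coordinate_embedding e n x) $ e i)\<^sup>2) < 1"
proof -
  define emb :: "(nat \<Rightarrow> real) \<Rightarrow> real^'v" where "emb = coordinate_embedding e n"
  define prj :: "real^'v \<Rightarrow> nat \<Rightarrow> real" where "prj = (\<lambda>y i. if i \<le> n then y $ e i else 0)"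
  define C :: "(real^'v) set" where "C = sphere 0 1 \<inter> {y. \<forall>v. v \<notin> e ` {..n} \<longrightarrow> y $ v = 0}"
  note emb_e = coordinate_embedding_nth[OF e, folded emb_def]
  note emb_0 = coordinate_embedding_other[of _ e n, folded emb_def]
  have norm_sq: "(norm y)\<^sup>2 = (\<Sum>v\<in>UNIV. (y $ v)\<^sup>2)" for y :: "real^'v"
    unfolding power2_norm_eq_inner inner_vec_def by (simp add: power2_eq_square)
  have part_le: "(\<Sum>i\<le>n. (y $ e i)\<^sup>2) \<le> (norm y)\<^sup>2" for y :: "real^'v"
  proof -
    have "(\<Sum>i\<le>n. (y $ e i)\<^sup>2) = (\<Sum>v\<in>e ` {..n}. (y $ v)\<^sup>2)"
      using e by (simp add: sum.reindex)
    then show ?thesis unfolding norm_sq by (auto intro: sum_mono2)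
  qed
  have part_eq: "(\<Sum>i\<le>n. (y $ e i)\<^sup>2) = (norm y)\<^sup>2"
    if "\<And>v. v \<notin> e ` {..n} \<Longrightarrow> y $ v = 0" for y :: "real^'v"
  proof -
    have "(\<Sum>i\<le>n. (y $ e i)\<^sup>2) = (\<Sum>v\<in>e ` {..n}. (y $ v)\<^sup>2)"
      using e by (simp add: sum.reindex)
    also have "\<dots> = (norm y)\<^sup>2" unfolding norm_sq
      using that by (intro sum.mono_neutral_left) auto
    finally show ?thesis .
  qed
  have prj_emb: "prj (emb x) = x" if "x \<in> topspace (nsphere n)" for x
    using that by (auto simp: prj_def emb_e topspace_nsphere)
  have emb_C: "emb x \<in> C" if "x \<in> topspace (nsphere n)" for x
  proof -
    have "(norm (emb x))\<^sup>2 = 1"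
      using part_eq[of "emb x"] that by (simp add: emb_0 emb_e topspace_nsphere)
    then have "norm (emb x) = 1"
      by (simp add: power2_eq_1_iff) (metis norm_ge_zero not_one_le_zero neg_0_le_iff_le)
    then show ?thesis by (simp add: C_def emb_0)
  qed
  have prj_S: "prj y \<in> topspace (nsphere n)" if "y \<in> C" for y
    using part_eq[of y] that by (simp add: C_def prj_def topspace_nsphere)
  have "continuous_map (top_of_set C) (nsphere n) prj"
    unfolding nsphere continuous_map_in_subtopology continuous_map_componentwise_UNIV
  proof (intro conjI allI)
    show "continuous_map (top_of_set C) euclideanreal (\<lambda>y. prj y k)" for k
      by (cases "k \<le> n") (auto simp: prj_def intro!: continuous_intros)
    show "prj \<in> topspace (top_of_set C) \<rightarrow> {x. (\<Sum>i\<le>n. (x i)\<^sup>2) = 1 \<and> (\<forall>i>n. x i = 0)}"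
      using prj_S by (auto simp: topspace_nsphere)
  qed
  then have "continuous_map (top_of_set C) (nsphere n) (f \<circ> prj)"
    using f by (rule continuous_map_compose)
  from continuous_map_compose[OF this continuous_map_nsphere_projection]
  have comp: "continuous_on C (\<lambda>y. f (prj y) i)" for i
    by (simp add: o_def)
  have contF: "continuous_on C (\<lambda>y. emb (f (prj y)))"
    unfolding emb_def coordinate_embedding_def by (intro continuous_intros comp)
  have "closed {y::real^'v. \<forall>v. v \<notin> e ` {..n} \<longrightarrow> y $ v = 0}"
    by (intro closed_Collect_all closed_Collect_imp closed_Collect_eq continuous_intros) auto
  then have "compact C" unfolding C_def by (intro compact_Int_closed) auto
  have C_minus: "- y \<in> C" if "y \<in> C" for y using that by (auto simp: C_def)
  have oddF: "emb (f (prj (- y))) = - emb (f (prj y))" if "y \<in> C" for y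
  proof -
    have "prj (- y) = (\<lambda>i. - prj y i)" by (auto simp: prj_def)
    then show ?thesis using odd[OF prj_S[OF that]] by (simp add: emb_def coordinate_embedding_minus)
  qed
  obtain P where P: "polynomial_function P" "\<And>y. P (- y) = - P y"
    "\<And>y. y \<in> C \<Longrightarrow> norm (emb (f (prj y)) - P y) < 1"
    using odd_polynomial_approximation[OF \<open>compact C\<close> contF zero_less_one C_minus oddF] by metis
  have "(\<Sum>i\<le>n. (f x i - P (emb x) $ e i)\<^sup>2) < 1" if x: "x \<in> topspace (nsphere n)" for x
  proof -
    have "(\<Sum>i\<le>n. (f x i - P (emb x) $ e i)\<^sup>2) = (\<Sum>i\<le>n. ((emb (f x) - P (emb x)) $ e i)\<^sup>2)"
      by (intro sum.cong) (auto simp: emb_e)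
    also have "\<dots> \<le> (norm (emb (f x) - P (emb x)))\<^sup>2" by (rule part_le)
    also have "\<dots> < 1"
      using P(3)[OF emb_C[OF x]] prj_emb[OF x] by (simp add: abs_square_less_1)
    finally show ?thesis .
  qed
  with P(1,2) show thesis using that unfolding emb_def by blast
qed

section \<open>Odd maps of spheres have odd degree\<close>

text \<open>
  The induction rests on \<open>Borsuk_odd_mapping_degree_step\<close>: if an odd self-map of the sphere
  preserves the equator, then modulo 2 it has the same degree as its restriction to the equator. An
  arbitrary odd map \<open>f\<close> of the sphere of dimension \<open>n + 1\<close> is first deformed into this form.
  Approximate it by an odd polynomial map \<open>p\<close> and choose \<open>d\<close> such that \<open>p\<close> maps no point of the
  equator to the line spanned by \<open>(d, 1)\<close>. Replacing \<open>p\<^sub>i\<close> by \<open>p\<^sub>i - d\<^sub>i * p\<^sub>n\<^sub>+\<^sub>1\<close> for \<open>i \<le> n\<close> is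
  a shear that turns this line into the last axis. Multiplying the last component by
  \<open>x\<^sub>n\<^sub>+\<^sub>1\<^sup>2\<close>, which is even and vanishes exactly on the equator, then pushes the equator into itself.
  A zero of the resulting map would be a zero of \<open>p\<close>, or a point of the equator that \<open>p\<close> maps to
  the line; neither exists. The same argument applies along the segment from \<open>p\<close> to that map.

  The finite type \<open>'v\<close> only supplies a Euclidean space of dimension greater than \<open>n\<close>.
\<close>

theorem Borsuk_odd_mapping_degree:
  assumes "n < CARD('v::finite)"
    and f: "continuous_map (nsphere n) (nsphere n) f"
    and odd: "\<And>x. x \<in> topspace (nsphere n) \<Longrightarrow> f (\<lambda>i. - x i) = (\<lambda>i. - f x i)"
  shows "odd (Brouwer_degree2 n f)"
  using assms
proof (induction n arbitrary: f)
  case 0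
  have top0: "topspace (nsphere 0) = {x. (x 0 = 1 \<or> x 0 = - 1) \<and> (\<forall>i>0. x i = 0)}"
    by (simp add: topspace_nsphere power2_eq_1_iff)
  define a :: "nat \<Rightarrow> real" where "a = (\<lambda>i. if i = 0 then 1 else 0)"
  have two: "x = a \<or> x = (\<lambda>i. - a i)" if "x \<in> topspace (nsphere 0)" for x
    using that by (auto simp: top0 a_def fun_eq_iff)
  have a: "a \<in> topspace (nsphere 0)" by (simp add: top0 a_def)
  then have "f a \<in> topspace (nsphere 0)"
    using 0(2) continuous_map_image_subset_topspace by blast
  then consider "f a = a" | "f a = (\<lambda>i. - a i)" using two by blast
  then show ?case
  proof cases
    case 1
    then have "f x = id x" if "x \<in> topspace (nsphere 0)" for x
      using two[OF that] 0(3)[OF a] by auto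
    then have "Brouwer_degree2 0 f = Brouwer_degree2 0 id" by (rule Brouwer_degree2_eq)
    then show ?thesis by simp
  next
    case 2
    then have "f x = (\<lambda>i. if i = 0 then - x i else x i)" if "x \<in> topspace (nsphere 0)" for x
    proof -
      have "(\<lambda>i. if i = 0 then - x i else x i) = (\<lambda>i. - x i)"
        using that by (auto simp: top0 fun_eq_iff)
      moreover have "f x = (\<lambda>i. - x i)" using two[OF that] 0(3)[OF a] 2 by auto
      ultimately show ?thesis by simp
    qed
    then have "Brouwer_degree2 0 f = Brouwer_degree2 0 (\<lambda>x i. if i = 0 then - x i else x i)"
      by (rule Brouwer_degree2_eq)
    then show ?thesis by (simp add: Brouwer_degree2_reflection)
  qed
next
  case (Suc n)
  let ?S = "topspace (nsphere (Suc n))"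
  obtain e :: "nat \<Rightarrow> 'v" where bij: "bij_betw e {0..<CARD('v)} UNIV"
    using ex_bij_betw_nat_finite[of "UNIV :: 'v set"] by auto
  then have e: "inj_on e {..Suc n}"
    using Suc.prems(1) by (auto simp: bij_betw_def elim!: inj_on_subset)
  obtain P :: "real^'v \<Rightarrow> real^'v" where P: "polynomial_function P" "\<And>y. P (- y) = - P y"
    "\<And>x. x \<in> ?S \<Longrightarrow> (\<Sum>i\<le>Suc n. (f x i - P (coordinate_embedding e (Suc n) x) $ e i)\<^sup>2) < 1"
    using odd_map_polynomial_model[OF e Suc.prems(2,3)] by blast
  define emb :: "(nat \<Rightarrow> real) \<Rightarrow> real^'v" where "emb = coordinate_embedding e (Suc n)"
  note emb_e = coordinate_embedding_nth[OF e, folded emb_def]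
  note emb_0 = coordinate_embedding_other[of _ e "Suc n", folded emb_def]
  define p where "p = (\<lambda>x i. P (emb x) $ e i)"
  have close: "(\<Sum>i\<le>Suc n. (f x i - p x i)\<^sup>2) < 1" if "x \<in> ?S" for x
    using P(3)[OF that] by (simp add: p_def emb_def)
  have f_sphere: "f x \<in> ?S" if "x \<in> ?S" for x
    using Suc.prems(2) that continuous_map_image_subset_topspace by blast
  \<comment> \<open>A zero on the segment would give \<open>f x = t * (f x - p x)\<close>, a vector of length less than \<open>1\<close>.\<close>
  have segment1: "\<exists>i\<le>Suc n. (1 - t) * f x i + t * p x i \<noteq> 0"
    if x: "x \<in> ?S" and t: "0 \<le> t" "t \<le> 1" for x t
  proof (rule ccontr)
    assume "\<not> ?thesis"
    then have "f x i = t * (f x i - p x i)" if "i \<le> Suc n" for i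
      using that by (auto simp: algebra_simps)
    then have "(\<Sum>i\<le>Suc n. (f x i)\<^sup>2) = (\<Sum>i\<le>Suc n. (t * (f x i - p x i))\<^sup>2)"
      by (intro sum.cong) auto
    also have "\<dots> = t\<^sup>2 * (\<Sum>i\<le>Suc n. (f x i - p x i)\<^sup>2)"
      by (simp add: power_mult_distrib sum_distrib_left del: sum.atMost_Suc)
    also have "\<dots> \<le> 1 * (\<Sum>i\<le>Suc n. (f x i - p x i)\<^sup>2)"
      using t by (intro mult_right_mono sum_nonneg) (auto simp: power_le_one)
    also have "\<dots> < 1" using close[OF x] by simp
    finally show False using f_sphere[OF x] by (simp add: topspace_nsphere)
  qed
  have p_nz: "\<exists>i\<le>Suc n. p x i \<noteq> 0" if "x \<in> ?S" for x
    using segment1[OF that, of 1] by simp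
  have contP: "continuous_on UNIV P"
    using P(1) by (rule continuous_on_polymonial_function)
  have cont_emb: "continuous_map (nsphere (Suc n)) euclidean emb"
  proof -
    have "continuous_map (top_of_set ?S) euclidean emb"
      unfolding emb_def coordinate_embedding_def continuous_map_iff_continuous
      by (intro continuous_on_sum continuous_on_scaleR continuous_on_const
          continuous_on_subset[OF continuous_on_product_coordinates]) auto
    then show ?thesis by (simp add: nsphere euclidean_product_topology)
  qed
  have cont_p: "continuous_map (nsphere (Suc n)) euclideanreal (\<lambda>x. p x i)" for i
  proof -
    have "continuous_map euclidean euclideanreal (\<lambda>y. P y $ e i)"
      using contP by (auto intro!: continuous_intros)
    from continuous_map_compose[OF cont_emb this] show ?thesis by (simp add: p_def o_def)
  qed
  have p_minus: "p (\<lambda>i. - x i) = (\<lambda>i. - p x i)" for x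
    by (simp add: p_def emb_def coordinate_embedding_minus P(2))
  obtain d :: "real^'v" where d:
    "\<And>y. \<lbrakk>(\<Sum>v\<in>e ` {..n}. (y $ v)\<^sup>2) = 1; \<And>v. v \<notin> e ` {..n} \<Longrightarrow> y $ v = 0; P y $ e (Suc n) \<noteq> 0\<rbrakk>
        \<Longrightarrow> \<exists>v\<in>e ` {..n}. P y $ v \<noteq> d $ v * P y $ e (Suc n)"
  proof (rule missing_slope[of P "\<lambda>y. P y $ e (Suc n)" "e ` {..n}"])
    show diff: "P differentiable (at y)" for y
      using P(1) by (rule differentiable_at_polynomial_function)
    show "(\<lambda>y. P y $ e (Suc n)) differentiable (at y)" for y
      using differentiable_chain_at[OF diff[of y]
          bounded_linear_imp_differentiable[OF bounded_linear_vec_nth[of "e (Suc n)"]]]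
      by (simp add: o_def)
  qed blast
  define q where "q = (\<lambda>x i. if i = Suc n then (x (Suc n))\<^sup>2 * p x (Suc n)
                                else p x i - d $ e i * p x (Suc n))"
  have equator: "\<exists>i\<le>n. q x i \<noteq> 0" if x: "x \<in> ?S" "x (Suc n) = 0" for x
  proof (cases "p x (Suc n) = 0")
    case True
    then obtain i where i: "i \<le> n" "p x i \<noteq> 0" using p_nz[OF x(1)] by (metis le_Suc_eq)
    then have "q x i = p x i" using True by (simp add: q_def)
    with i show ?thesis by metis
  next
    case False
    have "(\<Sum>v\<in>e ` {..n}. (emb x $ v)\<^sup>2) = (\<Sum>i\<le>n. (x i)\<^sup>2)"
      using inj_on_subset[OF e, of "{..n}"] by (simp add: sum.reindex emb_e)
    also have "\<dots> = 1" using x by (simp add: topspace_nsphere)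
    finally have 1: "(\<Sum>v\<in>e ` {..n}. (emb x $ v)\<^sup>2) = 1" .
    have 2: "emb x $ v = 0" if "v \<notin> e ` {..n}" for v
    proof (cases "v = e (Suc n)")
      case True
      then show ?thesis using emb_e[of "Suc n" x] x(2) by simp
    next
      case False
      then have "v \<notin> e ` {..Suc n}" using that by (auto simp: le_Suc_eq)
      then show ?thesis by (rule emb_0)
    qed
    have "P (emb x) $ e (Suc n) \<noteq> 0" using False by (simp add: p_def)
    from d[OF 1 2 this] obtain i where i: "i \<le> n"
      "P (emb x) $ e i \<noteq> d $ e i * P (emb x) $ e (Suc n)" by blast
    then have "q x i \<noteq> 0" by (simp add: q_def p_def)
    with i(1) show ?thesis by metis
  qed
  have segment2: "\<exists>i\<le>Suc n. (1 - t) * p x i + t * q x i \<noteq> 0"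
    if x: "x \<in> ?S" and t: "0 \<le> t" "t \<le> 1" for x t
  proof (rule ccontr)
    assume "\<not> ?thesis"
    then have zero: "(1 - t) * p x i + t * q x i = 0" if "i \<le> Suc n" for i using that by blast
    from zero[of "Suc n"] have "((1 - t) + t * (x (Suc n))\<^sup>2) * p x (Suc n) = 0"
      by (simp add: q_def algebra_simps)
    then consider "p x (Suc n) = 0" | "(1 - t) + t * (x (Suc n))\<^sup>2 = 0" by auto
    then show False
    proof cases
      case 1
      then have "p x i = 0" if "i \<le> Suc n" for i
        using zero[OF that] that by (cases "i = Suc n") (auto simp: q_def algebra_simps)
      then show False using p_nz[OF x] by blast
    next
      case 2
      have "0 \<le> t * (x (Suc n))\<^sup>2" using t by simp
      with 2 t have "t = 1" by linarith
      with 2 have "x (Suc n) = 0" by simp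
      then have "\<exists>i\<le>n. q x i \<noteq> 0" by (rule equator[OF x])
      then show False using zero \<open>t = 1\<close>
        by (metis cancel_comm_monoid_add_class.diff_cancel le_SucI mult_1 mult_zero_left add_0)
    qed
  qed
  have q_nz: "\<exists>i\<le>Suc n. q x i \<noteq> 0" if "x \<in> ?S" for x
    using segment2[OF that, of 1] by simp
  have cont_f: "continuous_map (nsphere (Suc n)) euclideanreal (\<lambda>x. f x i)" for i
    using continuous_map_compose[OF Suc.prems(2) continuous_map_nsphere_projection]
    by (simp add: o_def)
  have cont_q: "continuous_map (nsphere (Suc n)) euclideanreal (\<lambda>x. q x i)" for i
    by (cases "i = Suc n")
      (auto simp: q_def intro!: continuous_intros cont_p continuous_map_nsphere_projection)
  define g where "g = (\<lambda>x. radial (Suc n) (q x))"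
  have "Brouwer_degree2 (Suc n) f = Brouwer_degree2 (Suc n) (\<lambda>x. radial (Suc n) (f x))"
    by (rule Brouwer_degree2_eq) (simp add: radial_of_nsphere f_sphere)
  also have "\<dots> = Brouwer_degree2 (Suc n) (\<lambda>x. radial (Suc n) (p x))"
    by (rule Brouwer_degree2_radial_segment[OF cont_f cont_p segment1])
  also have "\<dots> = Brouwer_degree2 (Suc n) g"
    unfolding g_def by (rule Brouwer_degree2_radial_segment[OF cont_p cont_q segment2])
  finally have deg_f: "Brouwer_degree2 (Suc n) f = Brouwer_degree2 (Suc n) g" .
  have cont_g: "continuous_map (nsphere (Suc n)) (nsphere (Suc n)) g"
    unfolding g_def by (rule continuous_map_radial[OF cont_q q_nz])
  have g_minus: "g (\<lambda>i. - x i) = (\<lambda>i. - g x i)" for x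
  proof -
    have "q (\<lambda>i. - x i) = (\<lambda>i. - q x i)" by (auto simp: q_def p_minus fun_eq_iff)
    then show ?thesis by (simp add: g_def radial_minus)
  qed
  have sub: "nsphere n = subtopology (nsphere (Suc n)) {x. x (Suc n) = 0}"
    by (simp add: subtopology_nsphere_equator)
  have g_equator: "g x \<in> topspace (nsphere n)" if "x \<in> topspace (nsphere n)" for x
  proof -
    have x: "x \<in> ?S" "x (Suc n) = 0" using that unfolding sub by auto
    then have "q x (Suc n) = 0" by (simp add: q_def)
    then have "g x (Suc n) = 0" by (simp add: g_def radial_def)
    moreover have "g x \<in> ?S" unfolding g_def by (rule radial_in_nsphere[OF q_nz[OF x(1)]])
    ultimately show ?thesis unfolding sub by simp
  qed
  have "continuous_map (nsphere n) (nsphere (Suc n)) g"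
    unfolding sub by (rule continuous_map_from_subtopology[OF cont_g])
  then have "continuous_map (nsphere n) (nsphere n) g"
    using g_equator unfolding sub continuous_map_in_subtopology by auto
  then have "odd (Brouwer_degree2 n g)"
    using Suc.prems(1) g_minus by (intro Suc.IH) auto
  moreover have "even (Brouwer_degree2 (Suc n) g - Brouwer_degree2 (Suc n - Suc 0) g)"
    by (rule Borsuk_odd_mapping_degree_step[OF cont_g]) (use g_equator g_minus in auto)
  ultimately show ?case unfolding deg_f by simp
qed

section \<open>The genus of a set that receives a sphere\<close>

text \<open>
  This is the Borsuk-Ulam theorem in the form needed for the genus. An odd map to
  \<open>\<real>\<^sup>m - {0}\<close> with \<open>m \<le> n\<close> would give an odd self-map of the \<open>n\<close>-sphere with image in the equator;
  it is not surjective, so its degree is \<open>0\<close>, which is not odd.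
\<close>

lemma genus_ge_sphere:
  fixes A :: "(real ^ 'v::finite) set"
  assumes n: "n < CARD('v)"
    and \<psi>: "continuous_map (nsphere n) (top_of_set A) \<psi>"
    and odd: "\<And>x. x \<in> topspace (nsphere n) \<Longrightarrow> \<psi> (\<lambda>i. - x i) = - \<psi> x"
  shows "enat (Suc n) \<le> genus A"
proof -
  have \<psi>_A: "\<psi> x \<in> A" if "x \<in> topspace (nsphere n)" for x
    using continuous_map_image_subset_topspace[OF \<psi>] that by auto
  have "Suc n \<le> m" if h: "odd_map_into A m h" for m h
  proof (rule ccontr)
    assume "\<not> Suc n \<le> m"
    then have m: "m \<le> n" by simp
    have "continuous_map (nsphere n)
        (subtopology (Euclidean_space m) (topspace (Euclidean_space m) - {\<lambda>i. 0})) (h \<circ> \<psi>)"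
      using h continuous_map_compose[OF \<psi>] unfolding odd_map_into_def by blast
    then have cont: "continuous_map (nsphere n) euclideanreal (\<lambda>x. h (\<psi> x) i)"
      and im: "x \<in> topspace (nsphere n) \<Longrightarrow> h (\<psi> x) \<in> topspace (Euclidean_space m) - {\<lambda>i. 0}" for x i
      unfolding continuous_map_in_subtopology Euclidean_space_def continuous_map_componentwise_UNIV
        Pi_iff o_def
      by auto
    have nz: "\<exists>i\<le>n. h (\<psi> x) i \<noteq> 0" if x: "x \<in> topspace (nsphere n)" for x
    proof -
      obtain i where i: "h (\<psi> x) i \<noteq> 0" using im[OF x] by blast
      moreover have "\<not> m \<le> i" using i im[OF x] by (auto simp: topspace_Euclidean_space)
      ultimately show ?thesis using m by (intro exI[of _ i]) auto
    qed
    define f where "f = (\<lambda>x. radial n (h (\<psi> x)))"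
    have cont_f: "continuous_map (nsphere n) (nsphere n) f"
      unfolding f_def by (rule continuous_map_radial[OF cont nz])
    have "f (\<lambda>i. - x i) = (\<lambda>i. - f x i)" if "x \<in> topspace (nsphere n)" for x
      using h \<psi>_A[OF that] odd[OF that] by (simp add: f_def odd_map_into_def radial_minus)
    then have "odd (Brouwer_degree2 n f)"
      by (rule Borsuk_odd_mapping_degree[OF n cont_f])
    moreover have "f ` topspace (nsphere n) \<noteq> topspace (nsphere n)"
    proof -
      define a :: "nat \<Rightarrow> real" where "a = (\<lambda>i. if i = n then 1 else 0)"
      have "(\<Sum>i\<le>n. (a i)\<^sup>2) = (\<Sum>i\<le>n. if i = n then 1 else 0)"
        by (intro sum.cong) (auto simp: a_def)
      then have "a \<in> topspace (nsphere n)" by (simp add: topspace_nsphere a_def)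
      moreover have "a \<noteq> f x" if "x \<in> topspace (nsphere n)" for x
      proof -
        have "f x n = 0"
          using im[OF that] m by (simp add: f_def radial_def topspace_Euclidean_space)
        moreover have "a n = 1" by (simp add: a_def)
        ultimately show ?thesis by (metis zero_neq_one)
      qed
      ultimately show ?thesis by blast
    qed
    then have "Brouwer_degree2 n f = 0" by (rule Brouwer_degree2_nonsurjective[OF cont_f])
    ultimately show False by simp
  qed
  moreover have "A \<noteq> {}" using \<psi>_A in_topspace_nsphere by blast
  ultimately show ?thesis by (auto simp: genus_def intro!: Inf_greatest)
qed

section \<open>Strong nodal domains\<close>

lemma connected_in_Un:
  assumes A: "connected_in E A" and B: "connected_in E B" and x: "x \<in> A" "x \<in> B"
  shows "connected_in E (A \<union> B)"
proof -
  have "(u, x) \<in> (E \<inter> (A \<union> B) \<times> (A \<union> B))\<^sup>* \<and> (x, u) \<in> (E \<inter> (A \<union> B) \<times> (A \<union> B))\<^sup>*"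
    if "u \<in> A \<union> B" for u
  proof -
    have "(E \<inter> A \<times> A)\<^sup>* \<subseteq> (E \<inter> (A \<union> B) \<times> (A \<union> B))\<^sup>*" "(E \<inter> B \<times> B)\<^sup>* \<subseteq> (E \<inter> (A \<union> B) \<times> (A \<union> B))\<^sup>*"
      by (intro rtrancl_mono; blast)+
    with that A B x show ?thesis unfolding connected_in_def by blast
  qed
  then show ?thesis using x unfolding connected_in_def by (blast intro: rtrancl_trans)
qed

lemma component_of_absorb:
  assumes A: "component_of E S A" and B: "connected_in E B" "B \<subseteq> S" and x: "x \<in> A" "x \<in> B"
  shows "B \<subseteq> A"
proof -
  have "connected_in E (A \<union> B)"
    using connected_in_Un[OF _ B(1) x] A by (simp add: component_of_def)
  then have "A \<union> B = A" using A B(2) unfolding component_of_def by blast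
  then show ?thesis by blast
qed

lemma component_of_eqI:
  assumes "component_of E S A" "component_of E S B" "x \<in> A" "x \<in> B"
  shows "A = B"
  using assms component_of_absorb[of E S A B x] component_of_absorb[of E S B A x]
  by (auto simp: component_of_def)

text \<open>The two ends of an edge form a connected set, which the component must absorb.\<close>

lemma component_of_edge:
  assumes A: "component_of E S A" and "sym E" and u: "u \<in> A" and uv: "(u, v) \<in> E" and v: "v \<in> S"
  shows "v \<in> A"
proof -
  have "(v, u) \<in> E" using \<open>sym E\<close> uv by (rule symD)
  then have "(a, b) \<in> (E \<inter> {u, v} \<times> {u, v})\<^sup>*" if "a \<in> {u, v}" "b \<in> {u, v}" for a b
    using that uv by (cases "a = b") auto
  then have "connected_in E {u, v}" unfolding connected_in_def by blast
  moreover have "{u, v} \<subseteq> S" using A u v by (auto simp: component_of_def)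
  ultimately show ?thesis using component_of_absorb[OF A _ _ u, of "{u, v}"] by blast
qed

lemma component_of_subset: "component_of E S A \<Longrightarrow> A \<subseteq> S"
  by (simp add: component_of_def)

lemma strong_nodal_domain_cases:
  assumes "strong_nodal_domain E f A" "u \<in> A"
  obtains "f $ u > 0" "component_of E {u. f $ u > 0} A"
  | "f $ u < 0" "component_of E {u. f $ u < 0} A"
  using assms unfolding strong_nodal_domain_def by (blast dest: component_of_subset)

lemma strong_nodal_domain_nonzero: "strong_nodal_domain E f A \<Longrightarrow> u \<in> A \<Longrightarrow> f $ u \<noteq> 0"
  by (erule (1) strong_nodal_domain_cases) auto

lemma strong_nodal_domain_nonempty: "strong_nodal_domain E f A \<Longrightarrow> A \<noteq> {}"
  unfolding strong_nodal_domain_def component_of_def connected_in_def by blast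

lemma strong_nodal_domain_eqI:
  assumes A: "strong_nodal_domain E f A" and B: "strong_nodal_domain E f B" and u: "u \<in> A" "u \<in> B"
  shows "A = B"
  using A u(1)
proof (cases rule: strong_nodal_domain_cases)
  case 1
  with B u(2) have "component_of E {u. f $ u > 0} B"
    by (metis strong_nodal_domain_cases less_asym)
  with 1(2) show ?thesis using u by (rule component_of_eqI)
next
  case 2
  with B u(2) have "component_of E {u. f $ u < 0} B"
    by (metis strong_nodal_domain_cases less_asym)
  with 2(2) show ?thesis using u by (rule component_of_eqI)
qed

lemma strong_nodal_domain_edge:
  assumes A: "strong_nodal_domain E f A" and "sym E" and u: "u \<in> A" and uv: "(u, v) \<in> E"
    and same: "f $ u * f $ v > 0"
  shows "v \<in> A"
  using A u
proof (cases rule: strong_nodal_domain_cases)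
  case 1
  then have "v \<in> {u. f $ u > 0}" using same by (simp add: zero_less_mult_iff)
  then show ?thesis by (rule component_of_edge[OF 1(2) \<open>sym E\<close> u uv])
next
  case 2
  then have "v \<in> {u. f $ u < 0}" using same by (simp add: zero_less_mult_iff)
  then show ?thesis by (rule component_of_edge[OF 2(2) \<open>sym E\<close> u uv])
qed

text \<open>A choice of one vertex in each domain is injective, the domains being disjoint.\<close>

lemma card_strong_nodal_domains_le:
  fixes f :: "real ^ 'v::finite"
  shows "card {A. strong_nodal_domain E f A} \<le> CARD('v)"
proof -
  let ?r = "\<lambda>A::'v set. SOME u. u \<in> A"
  have r: "?r A \<in> A" if "strong_nodal_domain E f A" for A
    using strong_nodal_domain_nonempty[OF that] by (simp add: some_in_eq)
  have "inj_on ?r {A. strong_nodal_domain E f A}"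
  proof (rule inj_onI)
    fix A B
    assume "A \<in> {A. strong_nodal_domain E f A}" "B \<in> {A. strong_nodal_domain E f A}" "?r A = ?r B"
    then show "A = B" using strong_nodal_domain_eqI[of E f A B "?r A"] r[of A] r[of B] by simp
  qed
  then show ?thesis by (rule card_inj_on_le) auto
qed

text \<open>
  The span of the restrictions of \<open>f\<close> to its nodal domains. Coefficients on vertices are used in
  place of coefficients on domains: constancy along the edges inside a domain is all that the energy
  estimate asks for, and closedness under linear combinations is immediate.
\<close>

definition nodal_multiples :: "('v::finite \<times> 'v) set \<Rightarrow> real ^ 'v \<Rightarrow> (real ^ 'v) set"
  where "nodal_multiples E f =
    {g. \<exists>c. (\<forall>u v. (u, v) \<in> E \<longrightarrow> f $ u * f $ v > 0 \<longrightarrow> c u = c v) \<and> (\<forall>u. g $ u = c u * f $ u)}"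

lemma subspace_nodal_multiples: "subspace (nodal_multiples E f)"
proof (rule subspaceI)
  show "0 \<in> nodal_multiples E f"
    unfolding nodal_multiples_def by (auto intro!: exI[of _ "\<lambda>_. 0"])
next
  fix g h assume "g \<in> nodal_multiples E f" "h \<in> nodal_multiples E f"
  then obtain c d where
    "\<forall>u v. (u, v) \<in> E \<longrightarrow> f $ u * f $ v > 0 \<longrightarrow> c u = c v" "\<forall>u. g $ u = c u * f $ u"
    "\<forall>u v. (u, v) \<in> E \<longrightarrow> f $ u * f $ v > 0 \<longrightarrow> d u = d v" "\<forall>u. h $ u = d u * f $ u"
    unfolding nodal_multiples_def by blast
  then show "g + h \<in> nodal_multiples E f"
    unfolding nodal_multiples_def mem_Collect_eq
    by (intro exI[of _ "\<lambda>u. c u + d u"]) (metis vector_add_component distrib_right)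
next
  fix a g assume "g \<in> nodal_multiples E f"
  then obtain c where
    "\<forall>u v. (u, v) \<in> E \<longrightarrow> f $ u * f $ v > 0 \<longrightarrow> c u = c v" "\<forall>u. g $ u = c u * f $ u"
    unfolding nodal_multiples_def by blast
  then show "a *\<^sub>R g \<in> nodal_multiples E f"
    unfolding nodal_multiples_def mem_Collect_eq
    by (intro exI[of _ "\<lambda>u. a * c u"]) (metis vector_scaleR_component mult.assoc real_scaleR_def)
qed

section \<open>The energy of multiples of an eigenfunction\<close>

text \<open>
  Convexity extends from the open half-line to its endpoint because \<open>s powr p \<le> s\<close> for \<open>s\<close> in the
  unit interval.
\<close>

lemma powr_Jensen:
  fixes x y t p :: real
  assumes "p \<ge> 1" "x \<ge> 0" "y \<ge> 0" "0 \<le> t" "t \<le> 1"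
  shows "(t * x + (1 - t) * y) powr p \<le> t * x powr p + (1 - t) * y powr p"
proof -
  have small: "(s * z) powr p \<le> s * z powr p" if "0 \<le> s" "s \<le> 1" "z \<ge> 0" for s z
  proof -
    have "s powr p \<le> s powr 1" using that \<open>p \<ge> 1\<close> by (intro powr_mono') auto
    then show ?thesis using that by (simp add: powr_mult mult_right_mono)
  qed
  consider "x = 0" | "y = 0" | "x > 0" "y > 0" using assms by linarith
  then show ?thesis
  proof cases
    case 1
    then show ?thesis using small[of "1 - t" y] assms by simp
  next
    case 2
    then show ?thesis using small[of t x] assms by simp
  next
    case 3
    then show ?thesis
      using convex_onD[OF powr_convex[OF \<open>p \<ge> 1\<close>], of "1 - t" x y] assms
      by simp
  qed
qed

text \<open>Jensen's inequality for the weights \<open>a / (a + b)\<close> and \<open>b / (a + b)\<close>, multiplied by \<open>(a + b) powr p\<close>.\<close>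

lemma powr_weighted_power_mean:
  fixes a b c d p :: real
  assumes p: "p \<ge> 1" and a: "a > 0" and b: "b > 0"
  shows "\<bar>c * a + d * b\<bar> powr p \<le> (\<bar>c\<bar> powr p * a + \<bar>d\<bar> powr p * b) * (a + b) powr (p - 1)"
proof -
  define t where "t = a / (a + b)"
  have t: "0 \<le> t" "t \<le> 1" "1 - t = b / (a + b)" using a b by (auto simp: t_def field_simps)
  have mean: "x * a + y * b = (a + b) * (t * x + (1 - t) * y)" for x y
  proof -
    have "(a + b) * t = a" "(a + b) * (1 - t) = b" unfolding t(3) using a b by (simp_all add: t_def)
    then show ?thesis by (simp add: distrib_left flip: mult.assoc)
  qed
  have "\<bar>c * a + d * b\<bar> \<le> \<bar>c\<bar> * a + \<bar>d\<bar> * b"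
    using a b by (metis abs_mult abs_of_pos abs_triangle_ineq)
  then have "\<bar>c * a + d * b\<bar> powr p \<le> ((a + b) * (t * \<bar>c\<bar> + (1 - t) * \<bar>d\<bar>)) powr p"
    using p unfolding mean[symmetric] by (intro powr_mono2) auto
  also have "\<dots> = (a + b) powr p * (t * \<bar>c\<bar> + (1 - t) * \<bar>d\<bar>) powr p"
    by (rule powr_mult)
  also have "\<dots> \<le> (a + b) powr p * (t * \<bar>c\<bar> powr p + (1 - t) * \<bar>d\<bar> powr p)"
    using t p by (intro mult_left_mono powr_Jensen) auto
  also have "\<dots> = (a + b) powr (p - 1) * ((a + b) * (t * \<bar>c\<bar> powr p + (1 - t) * \<bar>d\<bar> powr p))"
    using powr_mult_base[of "a + b" "p - 1"] a b by (simp add: mult_ac)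
  finally show ?thesis unfolding mean[symmetric] by (simp add: mult.commute)
qed

lemma mult_sgn_powr:
  fixes t p :: real
  shows "t * (sgn t * \<bar>t\<bar> powr (p - 1)) = \<bar>t\<bar> powr p"
proof -
  have "t * (sgn t * \<bar>t\<bar> powr (p - 1)) = \<bar>t\<bar> * \<bar>t\<bar> powr (p - 1)"
    by (metis abs_sgn mult.assoc)
  then show ?thesis using powr_mult_base[of "\<bar>t\<bar>" "p - 1"] by simp
qed

text \<open>
  Here \<open>x\<close> and \<open>y\<close> are the values of an eigenfunction at the ends of an edge, \<open>z\<close> is its flux, and
  \<open>c\<close>, \<open>d\<close> are the coefficients. Only ends of opposite signs can make the inequality
  strict, and there it is convexity of the power. Equal signs force \<open>c = d\<close>, and a zero at one end
  leaves a single term; both sides then agree. For \<open>x = y\<close> both sides vanish whatever \<open>z\<close> is, so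
  the multivalued flux of the case \<open>p = 1\<close> is covered as well.
\<close>

lemma edge_energy_le:
  fixes x y c d z p :: real
  assumes p: "p \<ge> 1" and same: "x * y > 0 \<Longrightarrow> c = d"
    and z: "x \<noteq> y \<Longrightarrow> z = sgn (x - y) * \<bar>x - y\<bar> powr (p - 1)"
  shows "\<bar>c * x - d * y\<bar> powr p \<le> (\<bar>c\<bar> powr p * x - \<bar>d\<bar> powr p * y) * z"
proof (cases "x = y")
  case True
  show ?thesis
  proof (cases "x = 0")
    case False
    then have "c = d" using same True by (simp add: zero_less_mult_iff) linarith
    then show ?thesis using True by simp
  qed (use True in simp)
next
  case False
  note z = z[OF False]
  note base = mult_sgn_powr[where p = p]
  consider "x * y > 0" | "x = 0" | "y = 0" | "x > 0" "y < 0" | "x < 0" "y > 0"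
    by (metis linorder_neqE_linordered_idom mult_neg_neg mult_pos_pos)
  then show ?thesis
  proof cases
    case 1
    have "\<bar>d * (x - y)\<bar> powr p = \<bar>d\<bar> powr p * ((x - y) * z)"
      unfolding z base by (simp add: abs_mult powr_mult)
    then show ?thesis using same[OF 1] by (simp add: algebra_simps)
  next
    case 2
    have "(- y) * z = \<bar>y\<bar> powr p" unfolding z using base[of "- y"] 2 by simp
    then have "\<bar>d * y\<bar> powr p = \<bar>d\<bar> powr p * ((- y) * z)"
      by (simp only: abs_mult powr_mult)
    then show ?thesis using 2 by simp
  next
    case 3
    have "x * z = \<bar>x\<bar> powr p" unfolding z using base[of x] 3 by simp
    then have "\<bar>c * x\<bar> powr p = \<bar>c\<bar> powr p * (x * z)"
      by (simp only: abs_mult powr_mult)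
    then show ?thesis using 3 by simp
  next
    case 4
    then show ?thesis
      using powr_weighted_power_mean[OF p, of x "- y" c d] by (simp add: z)
  next
    case 5
    have "c * x - d * y = - (c * (- x) + d * y)" by simp
    then have "\<bar>c * x - d * y\<bar> = \<bar>c * (- x) + d * y\<bar>" by (simp only: abs_minus_cancel)
    then show ?thesis
      using 5 powr_weighted_power_mean[OF p, of "- x" y c d] by (simp add: z algebra_simps)
  qed
qed

text \<open>
  A common form of the two eigenvalue equations: an antisymmetric flux with the prescribed value on
  every edge on which \<open>f\<close> is not constant. Multiplying the equation by \<open>f u\<close> turns the right-hand
  side into a power of \<open>\<bar>f u\<bar>\<close>, which removes the ambiguity of \<open>Sign 0\<close>.
\<close>

lemma eigenfunction_flux:
  assumes f: "is_eigenfunction w \<mu> p lam f" and p: "p \<ge> 1"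
  obtains z where "\<And>u v. z u v = - z v u"
    "\<And>u v. f $ u \<noteq> f $ v \<Longrightarrow> z u v = sgn (f $ u - f $ v) * \<bar>f $ u - f $ v\<bar> powr (p - 1)"
    "\<And>u. f $ u * (\<Sum>v\<in>UNIV. w u v * z u v) = lam * \<mu> u * \<bar>f $ u\<bar> powr p"
proof (cases "p = 1")
  case True
  obtain z where z: "\<forall>u v. z u v = - z v u" "\<forall>u v. z u v \<in> Sign (f $ u - f $ v)"
    "\<forall>u. (\<Sum>v\<in>UNIV. w u v * z u v) \<in> (\<lambda>s. lam * \<mu> u * s) ` Sign (f $ u)"
    using f unfolding is_eigenfunction_def if_P[OF True] by blast
  have Sign: "s = sgn x" if "s \<in> Sign x" "x \<noteq> 0" for s x
    using that by (auto simp: Sign_def split: if_splits)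
  show thesis
  proof
    show "z u v = - z v u" for u v using z(1) by blast
    show "z u v = sgn (f $ u - f $ v) * \<bar>f $ u - f $ v\<bar> powr (p - 1)" if "f $ u \<noteq> f $ v" for u v
      using z(2) Sign[of "z u v" "f $ u - f $ v"] that True by simp
    show "f $ u * (\<Sum>v\<in>UNIV. w u v * z u v) = lam * \<mu> u * \<bar>f $ u\<bar> powr p" for u
    proof -
      obtain s where s: "s \<in> Sign (f $ u)" "(\<Sum>v\<in>UNIV. w u v * z u v) = lam * \<mu> u * s"
        using z(3) by blast
      have "f $ u * s = \<bar>f $ u\<bar>"
        using Sign[OF s(1)] by (cases "f $ u = 0") (simp, metis abs_sgn)
      then show ?thesis using s(2) True by (simp add: mult_ac)
    qed
  qed
next
  case False
  have eq: "\<And>u. p_laplacian w p f u = lam * \<mu> u * \<Phi> p (f $ u)"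
    using f unfolding is_eigenfunction_def if_not_P[OF False] by blast
  have \<Phi>: "\<Phi> p t = sgn t * \<bar>t\<bar> powr (p - 1)" if "t \<noteq> 0" for t
  proof -
    have "\<bar>t\<bar> * \<bar>t\<bar> powr (p - 2) = \<bar>t\<bar> powr (p - 1)"
      using powr_mult_base[of "\<bar>t\<bar>" "p - 2"] by simp
    then have "sgn t * \<bar>t\<bar> powr (p - 1) = (sgn t * \<bar>t\<bar>) * \<bar>t\<bar> powr (p - 2)"
      by (simp add: mult_ac)
    also have "sgn t * \<bar>t\<bar> = t" by (rule sgn_mult_abs)
    finally show ?thesis by (simp add: \<Phi>_def)
  qed
  have power: "x * \<Phi> p x = \<bar>x\<bar> powr p" for x
  proof (cases "x = 0")
    case False
    then show ?thesis by (simp add: \<Phi> mult_sgn_powr)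
  qed simp
  show thesis
  proof (rule that[of "\<lambda>u v. \<Phi> p (f $ u - f $ v)"])
    show "\<Phi> p (f $ u - f $ v) = - \<Phi> p (f $ v - f $ u)" for u v
      by (simp add: \<Phi>_def abs_minus_commute algebra_simps)
    show "f $ u * (\<Sum>v\<in>UNIV. w u v * \<Phi> p (f $ u - f $ v)) = lam * \<mu> u * \<bar>f $ u\<bar> powr p" for u
      using eq[of u] power[of "f $ u"] by (simp add: p_laplacian_def mult_ac)
  qed (simp add: \<Phi>)
qed

context weighted_graph
begin

text \<open>
  Summing the edge estimate over all edges and using antisymmetry of the flux (summation by parts),
  the right-hand side becomes the eigenvalue equation for \<open>f\<close> tested with \<open>\<bar>c\<bar> powr p * f\<close>,
  which gives \<open>lam\<close> times the \<open>p\<close>-th power of the \<open>p\<close>-norm of \<open>g\<close>.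
\<close>

lemma rayleigh_nodal_multiple_le:
  fixes f g :: "real ^ 'v"
  assumes p: "p \<ge> 1"
    and f: "is_eigenfunction w \<mu> p lam f"
    and g: "g \<in> nodal_multiples E f" "g \<in> p_sphere \<mu> p"
  shows "rayleigh w \<mu> p g \<le> lam"
proof -
  obtain z where anti: "\<And>u v. z u v = - z v u"
    and z: "\<And>u v. f $ u \<noteq> f $ v \<Longrightarrow> z u v = sgn (f $ u - f $ v) * \<bar>f $ u - f $ v\<bar> powr (p - 1)"
    and eigen: "\<And>u. f $ u * (\<Sum>v\<in>UNIV. w u v * z u v) = lam * \<mu> u * \<bar>f $ u\<bar> powr p"
    using eigenfunction_flux[OF f p] by blast
  obtain c where c: "\<And>u v. (u, v) \<in> E \<Longrightarrow> f $ u * f $ v > 0 \<Longrightarrow> c u = c v"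
    and gc: "\<And>u. g $ u = c u * f $ u"
    using g(1) unfolding nodal_multiples_def by blast
  define F where "F = (\<lambda>u. \<bar>c u\<bar> powr p * f $ u)"
  have edge: "w u v * \<bar>g $ u - g $ v\<bar> powr p \<le> w u v * ((F u - F v) * z u v)" for u v
  proof (cases "(u, v) \<in> E")
    case True
    have "\<bar>g $ u - g $ v\<bar> powr p \<le> (F u - F v) * z u v"
      unfolding gc F_def by (rule edge_energy_le[OF p c[OF True] z])
    then show ?thesis using w_edge[OF True] by (intro mult_left_mono) auto
  qed (simp add: w_non_edge)
  have "(\<Sum>u\<in>UNIV. \<Sum>v\<in>UNIV. w u v * F v * z u v) = (\<Sum>v\<in>UNIV. \<Sum>u\<in>UNIV. w u v * F v * z u v)"
    by (rule sum.swap)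
  also have "\<dots> = (\<Sum>v\<in>UNIV. \<Sum>u\<in>UNIV. - (w v u * F v * z v u))"
    by (intro sum.cong refl) (metis w_sym anti mult_minus_right)
  also have "\<dots> = - (\<Sum>u\<in>UNIV. \<Sum>v\<in>UNIV. w u v * F u * z u v)"
    by (simp add: sum_negf)
  finally have transpose: "(\<Sum>u\<in>UNIV. \<Sum>v\<in>UNIV. w u v * F v * z u v)
      = - (\<Sum>u\<in>UNIV. \<Sum>v\<in>UNIV. w u v * F u * z u v)" .
  have "(\<Sum>u\<in>UNIV. \<Sum>v\<in>UNIV. w u v * \<bar>g $ u - g $ v\<bar> powr p)
      \<le> (\<Sum>u\<in>UNIV. \<Sum>v\<in>UNIV. w u v * ((F u - F v) * z u v))"
    by (intro sum_mono edge)
  also have "\<dots> = (\<Sum>u\<in>UNIV. \<Sum>v\<in>UNIV. w u v * F u * z u v) - (\<Sum>u\<in>UNIV. \<Sum>v\<in>UNIV. w u v * F v * z u v)"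
    by (simp add: algebra_simps sum_subtractf)
  also have "\<dots> = 2 * (\<Sum>u\<in>UNIV. \<Sum>v\<in>UNIV. w u v * F u * z u v)"
    unfolding transpose by simp
  also have "(\<Sum>u\<in>UNIV. \<Sum>v\<in>UNIV. w u v * F u * z u v)
      = (\<Sum>u\<in>UNIV. \<bar>c u\<bar> powr p * (f $ u * (\<Sum>v\<in>UNIV. w u v * z u v)))"
    by (simp add: F_def sum_distrib_left mult_ac)
  also have "\<dots> = (\<Sum>u\<in>UNIV. lam * (\<mu> u * \<bar>g $ u\<bar> powr p))"
    by (intro sum.cong refl) (simp add: eigen gc abs_mult powr_mult)
  also have "\<dots> = lam * (\<Sum>u\<in>UNIV. \<mu> u * \<bar>g $ u\<bar> powr p)" by (rule sum_distrib_left[symmetric])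
  also have "\<dots> = lam" using g(2) by (simp add: p_sphere_def)
  finally show ?thesis using g(2) by (simp add: rayleigh_def p_sphere_def)
qed

section \<open>The sphere spanned by the nodal domains\<close>

lemma p_norm_pos:
  assumes "g \<noteq> 0"
  shows "(\<Sum>u\<in>UNIV. \<mu> u * \<bar>g $ u\<bar> powr p) > 0"
proof -
  obtain v where "g $ v \<noteq> 0" using assms by (auto simp: vec_eq_iff)
  then have "\<mu> v * \<bar>g $ v\<bar> powr p > 0" using \<mu>_pos by simp
  moreover have "\<mu> u * \<bar>g $ u\<bar> powr p \<ge> 0" for u using \<mu>_pos[of u] by simp
  ultimately show ?thesis by (intro sum_pos2[of UNIV v]) auto
qed

lemma normalize_in_p_sphere:
  assumes "g \<noteq> 0" and "p \<ge> 1"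
  shows "(1 / (\<Sum>u\<in>UNIV. \<mu> u * \<bar>g $ u\<bar> powr p) powr (1 / p)) *\<^sub>R g \<in> p_sphere \<mu> p"
proof -
  define N where "N = (\<Sum>u\<in>UNIV. \<mu> u * \<bar>g $ u\<bar> powr p)"
  have N: "N > 0" unfolding N_def by (rule p_norm_pos[OF assms(1)])
  have "\<bar>1 / N powr (1 / p)\<bar> powr p = 1 / N"
    using N assms(2) by (simp add: powr_divide powr_powr)
  then have "(\<Sum>u\<in>UNIV. \<mu> u * \<bar>((1 / N powr (1 / p)) *\<^sub>R g) $ u\<bar> powr p)
      = (\<Sum>u\<in>UNIV. (1 / N) * (\<mu> u * \<bar>g $ u\<bar> powr p))"
    by (intro sum.cong refl) (simp only: vector_scaleR_component real_scaleR_def abs_mult powr_mult mult_ac)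
  also have "\<dots> = (1 / N) * N" unfolding N_def by (rule sum_distrib_left[symmetric])
  also have "\<dots> = 1" using N by simp
  finally show ?thesis by (simp add: p_sphere_def N_def)
qed

lemma continuous_on_p_norm:
  fixes g :: "'a::topological_space \<Rightarrow> real ^ 'v"
  assumes "continuous_on S g" "p \<ge> 1"
  shows "continuous_on S (\<lambda>x. \<Sum>u\<in>UNIV. \<mu> u * \<bar>g x $ u\<bar> powr p)"
  using assms by (intro continuous_intros continuous_on_powr') auto

lemma closed_p_sphere: "p \<ge> 1 \<Longrightarrow> closed (p_sphere \<mu> p)"
  unfolding p_sphere_def by (intro closed_Collect_eq continuous_on_p_norm continuous_intros) auto

text \<open>
  The restrictions of \<open>f\<close> to its \<open>n + 1\<close> nodal domains have disjoint supports, so they are linearly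
  independent, and normalizing their combinations maps the \<open>n\<close>-sphere of coefficients into the set.
\<close>

lemma genus_nodal_multiples:
  fixes f :: "real ^ 'v"
  assumes p: "p \<ge> 1" and D: "card {A. strong_nodal_domain E f A} = Suc n"
  shows "enat (Suc n) \<le> genus (nodal_multiples E f \<inter> p_sphere \<mu> p)"
proof -
  obtain b where b: "bij_betw b {0..<Suc n} {A. strong_nodal_domain E f A}"
    using ex_bij_betw_nat_finite[of "{A. strong_nodal_domain E f A}"] D by auto
  have dom: "strong_nodal_domain E f (b i)" if "i \<le> n" for i
    using bij_betwE[OF b] that by auto
  have inj: "i = j" if "i \<le> n" "j \<le> n" "b i = b j" for i j
    using b that by (auto simp: bij_betw_def inj_on_def)
  define coef where "coef = (\<lambda>x u. \<Sum>i\<le>n. x i * of_bool (u \<in> b i) :: real)"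
  define \<phi> :: "(nat \<Rightarrow> real) \<Rightarrow> real ^ 'v" where "\<phi> = (\<lambda>x. \<chi> u. coef x u * f $ u)"
  define N where "N = (\<lambda>x. \<Sum>u\<in>UNIV. \<mu> u * \<bar>\<phi> x $ u\<bar> powr p)"
  define \<psi> where "\<psi> = (\<lambda>x. (1 / N x powr (1 / p)) *\<^sub>R \<phi> x)"
  have \<phi>_mult: "\<phi> x \<in> nodal_multiples E f" for x
  proof -
    have "coef x u = coef x v" if uv: "(u, v) \<in> E" "f $ u * f $ v > 0" for u v
    proof -
      have "u \<in> b i \<longleftrightarrow> v \<in> b i" if "i \<le> n" for i
        using strong_nodal_domain_edge[OF dom[OF that] undirected, of u v]
          strong_nodal_domain_edge[OF dom[OF that] undirected, of v u]
          uv symD[OF undirected uv(1)] by (auto simp: mult.commute)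
      then show ?thesis unfolding coef_def by (intro sum.cong) auto
    qed
    then show ?thesis unfolding nodal_multiples_def \<phi>_def by auto
  qed
  have \<phi>_nz: "\<phi> x \<noteq> 0" if x: "x \<in> topspace (nsphere n)" for x
  proof -
    obtain i where i: "i \<le> n" "x i \<noteq> 0" using nsphere_nonzero[OF x] by blast
    obtain u where u: "u \<in> b i" using strong_nodal_domain_nonempty[OF dom[OF i(1)]] by blast
    have "u \<in> b j \<longleftrightarrow> j = i" if "j \<le> n" for j
      using strong_nodal_domain_eqI[OF dom[OF that] dom[OF i(1)] _ u] inj[OF that i(1)] u by blast
    then have "coef x u = (\<Sum>j\<le>n. if j = i then x j else 0)"
      unfolding coef_def by (intro sum.cong) auto
    then have "coef x u = x i" using i by simp
    then have "\<phi> x $ u \<noteq> 0"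
      using i strong_nodal_domain_nonzero[OF dom[OF i(1)] u] by (simp add: \<phi>_def)
    then show ?thesis by auto
  qed
  have \<psi>_in: "\<psi> x \<in> nodal_multiples E f \<inter> p_sphere \<mu> p" if "x \<in> topspace (nsphere n)" for x
    using normalize_in_p_sphere[OF \<phi>_nz[OF that] p] subspace_scale[OF subspace_nodal_multiples \<phi>_mult]
    by (simp add: \<psi>_def N_def)
  have cont_coord: "continuous_on (topspace (nsphere n)) (\<lambda>x. x i)" for i
    by (rule continuous_on_subset[OF continuous_on_product_coordinates]) auto
  have cont_\<phi>: "continuous_on (topspace (nsphere n)) \<phi>"
    unfolding \<phi>_def coef_def
    by (intro continuous_on_vec_lambda continuous_on_mult continuous_on_sum continuous_on_const cont_coord)
  have N_pos: "N x > 0" if "x \<in> topspace (nsphere n)" for x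
    unfolding N_def by (rule p_norm_pos[OF \<phi>_nz[OF that]])
  have "continuous_on (topspace (nsphere n)) N"
    unfolding N_def by (rule continuous_on_p_norm[OF cont_\<phi> p])
  then have "continuous_on (topspace (nsphere n)) (\<lambda>x. N x powr (1 / p))"
    using N_pos by (intro continuous_on_powr continuous_on_const) (auto simp: less_imp_neq[THEN not_sym])
  then have "continuous_on (topspace (nsphere n)) \<psi>"
    unfolding \<psi>_def using N_pos
    by (intro continuous_on_scaleR continuous_on_divide continuous_on_const cont_\<phi>)
      (auto simp: less_imp_neq[THEN not_sym])
  then have "continuous_map (top_of_set (topspace (nsphere n)))
      (top_of_set (nodal_multiples E f \<inter> p_sphere \<mu> p)) \<psi>"
    using \<psi>_in by (auto simp: continuous_map_in_subtopology)
  moreover have "top_of_set (topspace (nsphere n)) = nsphere n"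
    by (simp add: nsphere euclidean_product_topology)
  ultimately have cont: "continuous_map (nsphere n)
      (top_of_set (nodal_multiples E f \<inter> p_sphere \<mu> p)) \<psi>" by simp
  have "\<phi> (\<lambda>i. - x i) = - \<phi> x" for x
    by (simp add: \<phi>_def coef_def vec_eq_iff sum_negf)
  then have "\<psi> (\<lambda>i. - x i) = - \<psi> x" for x
    by (simp add: \<psi>_def N_def)
  moreover have "n < CARD('v)"
    using card_strong_nodal_domains_le[of E f] D by simp
  ultimately show ?thesis using cont by (intro genus_ge_sphere) auto
qed

section \<open>Bounding a variational eigenvalue from above\<close>

lemma w_nonneg: "w u v \<ge> 0"
  using w_edge[of u v] w_non_edge[of u v] by (cases "(u, v) \<in> E") auto

lemma rayleigh_nonneg: "0 \<le> rayleigh w \<mu> p g"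
  unfolding rayleigh_def using w_nonneg \<mu>_pos
  by (intro mult_nonneg_nonneg divide_nonneg_nonneg sum_nonneg) (auto intro: less_imp_le)

lemma bdd_above_rayleigh:
  assumes p: "p \<ge> 1"
  shows "bdd_above (rayleigh w \<mu> p ` p_sphere \<mu> p)"
proof -
  define B where "B = (\<Sum>u\<in>UNIV. 1 / \<mu> u)"
  have "rayleigh w \<mu> p g \<le> 1 / 2 * (\<Sum>u\<in>UNIV. \<Sum>v\<in>UNIV. w u v * (2 * B powr (1 / p)) powr p)"
    if g: "g \<in> p_sphere \<mu> p" for g
  proof -
    have entry: "\<bar>g $ u\<bar> \<le> B powr (1 / p)" for u
    proof -
      have "\<mu> u * \<bar>g $ u\<bar> powr p \<le> (\<Sum>u\<in>UNIV. \<mu> u * \<bar>g $ u\<bar> powr p)"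
        by (intro member_le_sum mult_nonneg_nonneg less_imp_le[OF \<mu>_pos]) auto
      then have "\<bar>g $ u\<bar> powr p \<le> 1 / \<mu> u"
        using g \<mu>_pos[of u] by (simp add: p_sphere_def field_simps)
      also have "\<dots> \<le> B"
        unfolding B_def using \<mu>_pos by (intro member_le_sum) (auto intro: less_imp_le)
      finally have "(\<bar>g $ u\<bar> powr p) powr (1 / p) \<le> B powr (1 / p)"
        using p by (intro powr_mono2) auto
      then show ?thesis using p by (simp add: powr_powr)
    qed
    have "\<bar>g $ u - g $ v\<bar> powr p \<le> (2 * B powr (1 / p)) powr p" for u v
      using entry[of u] entry[of v] p by (intro powr_mono2) auto
    then have "(\<Sum>u\<in>UNIV. \<Sum>v\<in>UNIV. w u v * \<bar>g $ u - g $ v\<bar> powr p)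
        \<le> (\<Sum>u\<in>UNIV. \<Sum>v\<in>UNIV. w u v * (2 * B powr (1 / p)) powr p)"
      by (intro sum_mono mult_left_mono w_nonneg)
    then show ?thesis using g by (simp add: rayleigh_def p_sphere_def)
  qed
  then show ?thesis by (rule bdd_aboveI2)
qed

text \<open>
  Real infima and suprema carry information only for bounded nonempty sets. Here Rayleigh quotients
  are nonnegative and bounded on the sphere, and the sets of the family are nonempty because their
  genus is positive.
\<close>

lemma variational_eigenvalue_le:
  assumes p: "p \<ge> 1" and k: "k \<ge> 1" and A: "A \<in> genus_family \<mu> p k"
    and L: "\<And>g. g \<in> A \<Longrightarrow> rayleigh w \<mu> p g \<le> L"
  shows "variational_eigenvalue w \<mu> p k \<le> L"
proof -
  have nonempty: "B \<noteq> {}" if "B \<in> genus_family \<mu> p k" for B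
    using that k by (auto simp: genus_family_def genus_def zero_enat_def)
  have "0 \<le> (SUP g\<in>B. rayleigh w \<mu> p g)" if B: "B \<in> genus_family \<mu> p k" for B
  proof -
    obtain g where g: "g \<in> B" using nonempty[OF B] by blast
    have "bdd_above (rayleigh w \<mu> p ` B)"
      using B by (intro bdd_above_mono[OF bdd_above_rayleigh[OF p]]) (auto simp: genus_family_def)
    then have "rayleigh w \<mu> p g \<le> (SUP g\<in>B. rayleigh w \<mu> p g)" by (rule cSUP_upper[OF g])
    with rayleigh_nonneg[of p g] show ?thesis by linarith
  qed
  then have "bdd_below ((\<lambda>B. SUP g\<in>B. rayleigh w \<mu> p g) ` genus_family \<mu> p k)"
    by (rule bdd_belowI2)
  then have "variational_eigenvalue w \<mu> p k \<le> (SUP g\<in>A. rayleigh w \<mu> p g)"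
    unfolding variational_eigenvalue_def by (rule cINF_lower[OF _ A])
  also have "\<dots> \<le> L" using nonempty[OF A] L by (rule cSUP_least)
  finally show ?thesis .
qed

end

section \<open>The nodal count\<close>

theorem theorem3p4:
  fixes E :: "('v::finite \<times> 'v) set"
    and w :: "'v \<Rightarrow> 'v \<Rightarrow> real"
    and \<mu> :: "'v \<Rightarrow> real"
    and p lam :: real
    and k :: nat
  assumes "weighted_graph E w \<mu>"
    and "p \<ge> 1"
    and "k \<in> {1..CARD('v)}"
    and "is_eigenvalue w \<mu> p lam"
    and "lam < variational_eigenvalue w \<mu> p k"
  shows "\<forall>f. is_eigenfunction w \<mu> p lam f \<longrightarrow>
    card {A. strong_nodal_domain E f A} \<le> k - 1"
proof (intro allI impI, rule ccontr)
  fix f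
  assume f: "is_eigenfunction w \<mu> p lam f" and "\<not> card {A. strong_nodal_domain E f A} \<le> k - 1"
  then obtain n where D: "card {A. strong_nodal_domain E f A} = Suc n" and n: "k \<le> Suc n"
    by (cases "card {A. strong_nodal_domain E f A}") auto
  interpret weighted_graph E w \<mu> by (rule assms(1))
  let ?A = "nodal_multiples E f \<inter> p_sphere \<mu> p"
  have "- g \<in> ?A" if "g \<in> ?A" for g
    using that subspace_neg[OF subspace_nodal_multiples] by (auto simp: p_sphere_def)
  then have "uminus ` ?A = ?A" by (force intro: image_eqI[of _ _ "- _"])
  moreover have "closed ?A"
    using closed_p_sphere[OF assms(2)] closed_subspace[OF subspace_nodal_multiples] by (intro closed_Int)
  moreover have "enat k \<le> genus ?A"
    using genus_nodal_multiples[OF assms(2) D] n by (meson enat_ord_simps(1) order_trans)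
  ultimately have "?A \<in> genus_family \<mu> p k" by (simp add: genus_family_def)
  then have "variational_eigenvalue w \<mu> p k \<le> lam"
    using assms(3) rayleigh_nodal_multiple_le[OF assms(2) f]
    by (intro variational_eigenvalue_le[OF assms(2)]) auto
  with assms(5) show False by simp
qed

end
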